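(* Let $S$ be a semigroup, $\sigma:S\to S$ an involutive automorphism, and $\mu$ a linear combination of Dirac measures $(\delta_{z_i})_{i\in I}$ with every $z_i$ in the center of $S$. Let $\mathcal{A}$ be the set of functions $g:S\to\mathbb{C}$ such that $$g(xy)+g(x\sigma(y))=2g(x)g(y)\quad\text{for all }x,y\in S,$$ $$\int_S g(t)\,d\mu(t)\neq 0,\qquad \int_S g(xt)\,d\mu(t)=g(x)\int_S g(t)\,d\mu(t)\quad\text{for all }x\in S.$$ Let $\mathcal{K}$ be the set of non-zero functions $f:S\to\mathbb{C}$ such that $$\int_S f(xyt)\,d\mu(t)+\int_S f(x\sigma(y)t)\,d\mu(t)=2f(x)f(y)\quad\text{for all }x,y\in S.$$ For $g\in\mathcal{A}$ define $Tg:S\to\mathbb{C}$ by $Tg=\left(\int_S g(t)\,d\mu(t)\right)g$. Then: (1) $T$ is a bijection of $\mathcal{A}$ onto $\mathcal{K}$, and its inverse $T^{-1}:\mathcal{K}\to\mathcal{A}$ is given by $$(T^{-1}f)(x)=\frac{\int_S f(xt)\,d\mu(t)}{\int_S f(t)\,d\mu(t)}\quad\text{for all } f\in\mathcal{K},\ x\in S.$$ (2) Any $f\in\mathcal{K}$ is of the form $f=\left(\int_S g(t)\,d\mu(t)\right)g$ with $g\in\mathcal{A}$. Furthermore, $$f(x)=\int_S g(xt)\,d\mu(t)=\int_S g(x\sigma(t))\,d\mu(t)=\left(\int_S g(t)\,d\mu(t)\right)g(x)\quad\text{for all }x\in S.$$ (3) With $f$ and $g$ as in (2), $f$ is central if and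 only if $g$ is central. (4) With $f$ and $g$ as in (2), if $S$ is equipped with a topology and $\sigma:S\to S$ is continuous, then $f$ is continuous if and only if $g$ is continuous.
   Context: A semigroup is a set with an associative operation, written multiplicatively. An involutive automorphism of $S$ is a map $\sigma:S\to S$ with $\sigma(xy)=\sigma(x)\sigma(y)$ and $\sigma(\sigma(x))=x$ for all $x,y\in S$. The measure is $\mu=\sum_{i\in I}\alpha_i\delta_{z_i}$ (finite linear combination, $\alpha_i\in\mathbb{C}$), so $\int_S h(t)\,d\mu(t)=\sum_i\alpha_i h(z_i)$. A function $h$ on $S$ is central if $h(xy)=h(yx)$ for all $x,y\in S$. *)

theory Defs
  imports "HOL-Analysis.Analysis"
begin

definition involutive_automorphism :: "('a::semigroup_mult \<Rightarrow> 'a) \<Rightarrow> bool" where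
  "involutive_automorphism \<sigma> \<longleftrightarrow>
     (\<forall>x y. \<sigma> (x * y) = \<sigma> x * \<sigma> y) \<and> (\<forall>x. \<sigma> (\<sigma> x) = x)"

definition semigroup_center :: "'a::semigroup_mult set" where
  "semigroup_center = {z. \<forall>x. z * x = x * z}"

definition central_fun :: "('a::semigroup_mult \<Rightarrow> complex) \<Rightarrow> bool" where
  "central_fun h \<longleftrightarrow> (\<forall>x y. h (x * y) = h (y * x))"

(* The complex measure \<mu>, the sum over i in I of \<alpha> i times the Dirac measure at z i,
   is represented by the data I, \<alpha>, z; this is the integral of h with respect to \<mu>. *)
definition dirac_integral ::
    "'i set \<Rightarrow> ('i \<Rightarrow> complex) \<Rightarrow> ('i \<Rightarrow> 'a) \<Rightarrow> ('a \<Rightarrow> complex) \<Rightarrow> complex" where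
  "dirac_integral I \<alpha> z h = (\<Sum>i\<in>I. \<alpha> i * h (z i))"

definition dalembert_set ::
    "('a::semigroup_mult \<Rightarrow> 'a) \<Rightarrow> 'i set \<Rightarrow> ('i \<Rightarrow> complex) \<Rightarrow> ('i \<Rightarrow> 'a) \<Rightarrow> ('a \<Rightarrow> complex) set" where
  "dalembert_set \<sigma> I \<alpha> z = {g.
     (\<forall>x y. g (x * y) + g (x * \<sigma> y) = 2 * g x * g y) \<and>
     dirac_integral I \<alpha> z g \<noteq> 0 \<and>
     (\<forall>x. dirac_integral I \<alpha> z (\<lambda>t. g (x * t)) = g x * dirac_integral I \<alpha> z g)}"

definition kannappan_set ::
    "('a::semigroup_mult \<Rightarrow> 'a) \<Rightarrow> 'i set \<Rightarrow> ('i \<Rightarrow> complex) \<Rightarrow> ('i \<Rightarrow> 'a) \<Rightarrow> ('a \<Rightarrow> complex) set" where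
  "kannappan_set \<sigma> I \<alpha> z = {f. f \<noteq> (\<lambda>_. 0) \<and>
     (\<forall>x y. dirac_integral I \<alpha> z (\<lambda>t. f (x * y * t))
          + dirac_integral I \<alpha> z (\<lambda>t. f (x * \<sigma> y * t)) = 2 * f x * f y)}"

definition T_map ::
    "'i set \<Rightarrow> ('i \<Rightarrow> complex) \<Rightarrow> ('i \<Rightarrow> 'a) \<Rightarrow> ('a \<Rightarrow> complex) \<Rightarrow> ('a \<Rightarrow> complex)" where
  "T_map I \<alpha> z g = (\<lambda>x. dirac_integral I \<alpha> z g * g x)"

end

theory Submission
  imports Defs
begin

text \<open>
  For \<open>f \<in> \<K>\<close> put \<open>F x = \<integral> f (x t) d\<mu>(t)\<close> and \<open>G x = \<integral> f (x \<sigma> t) d\<mu>(t)\<close>.  Since \<open>f\<close> is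
  \<open>\<sigma>\<close>-invariant, \<open>G = F \<circ> \<sigma>\<close>.  Replacing \<open>x\<close> by \<open>x t\<close> and \<open>x \<sigma> t\<close>, respectively \<open>y\<close> by \<open>y t\<close> and
  \<open>\<sigma> y t\<close>, and integrating shows that \<open>(F + G) x f y = f x (F + G) y\<close>, so
  \<open>F + G = 2 c f\<close> for a constant \<open>c\<close>.  If \<open>c = 0\<close>, then \<open>F\<close> is odd under \<open>\<sigma>\<close>, and the functional
  equation forces \<open>f = 0\<close>.  Otherwise, putting \<open>y = t\<close> in the functional equation and integrating
  gives \<open>c F = (\<integral> f d\<mu>) f\<close>; so \<open>F\<close> is \<open>\<sigma>\<close>-invariant, hence \<open>F = c f\<close> and
  \<open>c\<^sup>2 = \<integral> f d\<mu>\<close>.  The preimage of \<open>f\<close> under \<open>T\<close> is then \<open>f / c\<close>.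
\<close>

lemma dirac_integral_cong:
  "(\<And>i. i \<in> I \<Longrightarrow> h (z i) = k (z i)) \<Longrightarrow> dirac_integral I \<alpha> z h = dirac_integral I \<alpha> z k"
  by (simp add: dirac_integral_def)

lemma dirac_integral_add:
  "dirac_integral I \<alpha> z (\<lambda>t. h t + k t) = dirac_integral I \<alpha> z h + dirac_integral I \<alpha> z k"
  by (simp add: dirac_integral_def ring_distribs sum.distrib)

lemma dirac_integral_mult_left:
  "dirac_integral I \<alpha> z (\<lambda>t. c * h t) = c * dirac_integral I \<alpha> z h"
  by (simp add: dirac_integral_def sum_distrib_left mult.left_commute)

lemma dirac_integral_mult_right:
  "dirac_integral I \<alpha> z (\<lambda>t. h t * c) = dirac_integral I \<alpha> z h * c"
  using dirac_integral_mult_left[of I \<alpha> z c h] by (simp add: mult.commute)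

lemma dirac_integral_swap:
  "dirac_integral I \<alpha> z (\<lambda>s. dirac_integral J \<beta> w (\<lambda>t. h s t)) =
   dirac_integral J \<beta> w (\<lambda>t. dirac_integral I \<alpha> z (\<lambda>s. h s t))"
  unfolding dirac_integral_def sum_distrib_left
  by (subst sum.swap) (simp add: mult.left_commute)

text \<open>Because \<open>\<sigma>\<close> is its own inverse, commutation of \<open>u\<close> with
  \<open>\<sigma> x\<close> carries over to commutation of \<open>\<sigma> u\<close> with
  \<open>x\<close>.\<close>

lemma involutive_automorphism_center:
  assumes "involutive_automorphism \<sigma>" and "u \<in> semigroup_center"
  shows "\<sigma> u \<in> semigroup_center"
proof -
  have "\<sigma> u * x = x * \<sigma> u" for x
  proof -
    have "\<sigma> (u * \<sigma> x) = \<sigma> (\<sigma> x * u)"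
      using assms(2) by (simp add: semigroup_center_def)
    then show ?thesis
      using assms(1) by (simp add: involutive_automorphism_def)
  qed
  then show ?thesis
    by (simp add: semigroup_center_def)
qed

lemma center_right_commute:
  "u \<in> semigroup_center \<Longrightarrow> x * u * y = x * y * u"
  by (simp add: semigroup_center_def mult.assoc)

text \<open>This feeds surjectivity of \<open>T_map\<close>: the eigenvalue equation reduces the
  functional equation for \<open>f\<close> to d'Alembert's equation for \<open>f / c\<close>, whose
  integral is then \<open>c\<close>.\<close>

proposition kannappan_eigenfunction:
  fixes \<sigma> :: "'a::semigroup_mult \<Rightarrow> 'a"
  assumes inv: "involutive_automorphism \<sigma>"
    and cent: "\<And>i. i \<in> I \<Longrightarrow> z i \<in> semigroup_center"
    and f: "f \<in> kannappan_set \<sigma> I \<alpha> z"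
  obtains c where "c \<noteq> 0" and "\<And>x. dirac_integral I \<alpha> z (\<lambda>t. f (x * t)) = c * f x"
    and "dirac_integral I \<alpha> z f = c\<^sup>2"
proof -
  define L where "L = dirac_integral I \<alpha> z"
  define F where "F x = L (\<lambda>t. f (x * t))" for x
  define G where "G x = L (\<lambda>t. f (x * \<sigma> t))" for x
  have \<sigma>m: "\<sigma> (x * y) = \<sigma> x * \<sigma> y" and \<sigma>\<sigma>: "\<sigma> (\<sigma> x) = x" for x y
    using inv by (auto simp: involutive_automorphism_def)
  \<comment> \<open>The measure lives on central points, so under \<open>L\<close> the variable
    \<open>t\<close>, and likewise \<open>\<sigma> t\<close>, may be moved past other
    factors.\<close>
  have L_cong: "L h = L k" if "\<And>t. t \<in> semigroup_center \<Longrightarrow> h t = k t" for h k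
    unfolding L_def by (rule dirac_integral_cong) (simp add: that cent)
  have K: "F (x * y) + F (x * \<sigma> y) = 2 * f x * f y" for x y
    using f by (simp add: kannappan_set_def F_def L_def)
  obtain a where a: "f a \<noteq> 0"
    using f by (auto simp: kannappan_set_def fun_eq_iff)
  \<comment> \<open>Replacing \<open>y\<close> by \<open>\<sigma> y\<close> only swaps the two
    summands on the left of \<open>K\<close>; at \<open>x = a\<close> the factor \<open>f a\<close>
    cancels.\<close>
  have even: "f (\<sigma> y) = f y" for y
    using K[of a y] K[of a "\<sigma> y"] a by (simp add: \<sigma>\<sigma> add.commute)
  have F\<sigma>: "F (\<sigma> x) = G x" for x
    using even[of "x * \<sigma> _"] by (simp add: F_def G_def \<sigma>m \<sigma>\<sigma>)
  have FF: "L (\<lambda>s. F (x * s * y)) = L (\<lambda>s. F (x * y * s))"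
    and FG: "L (\<lambda>s. F (x * \<sigma> s * y)) = L (\<lambda>s. F (x * y * \<sigma> s))" for x y
    by (auto intro!: L_cong arg_cong[where f = F] center_right_commute involutive_automorphism_center[OF inv])
  have x_sub: "L (\<lambda>s. F (x * y * s)) + L (\<lambda>s. F (x * \<sigma> y * s)) = 2 * F x * f y" for x y
  proof -
    have "L (\<lambda>s. F (x * s * y) + F (x * s * \<sigma> y)) = L (\<lambda>s. 2 * (f (x * s) * f y))"
      unfolding K by (simp add: mult.assoc)
    then show ?thesis
      unfolding FF[symmetric]
      by (simp add: F_def L_def dirac_integral_add dirac_integral_mult_left dirac_integral_mult_right)
  qed
  have x_sub\<sigma>: "L (\<lambda>s. F (x * y * \<sigma> s)) + L (\<lambda>s. F (x * \<sigma> y * \<sigma> s)) = 2 * G x * f y" for x y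
  proof -
    have "L (\<lambda>s. F (x * \<sigma> s * y) + F (x * \<sigma> s * \<sigma> y)) = L (\<lambda>s. 2 * (f (x * \<sigma> s) * f y))"
      unfolding K by (simp add: mult.assoc)
    then show ?thesis
      unfolding FG[symmetric]
      by (simp add: G_def L_def dirac_integral_add dirac_integral_mult_left dirac_integral_mult_right)
  qed
  have y_sub: "L (\<lambda>s. F (x * y * s)) + L (\<lambda>s. F (x * \<sigma> y * \<sigma> s)) = 2 * f x * F y" for x y
  proof -
    have "L (\<lambda>s. F (x * y * s) + F (x * \<sigma> y * \<sigma> s)) = L (\<lambda>s. 2 * f x * f (y * s))"
      using K[of x "y * _"] by (simp add: \<sigma>m mult.assoc)
    then show ?thesis
      by (simp add: F_def L_def dirac_integral_add dirac_integral_mult_left)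
  qed
  \<comment> \<open>The sum of \<open>x_sub\<close> and \<open>x_sub\<sigma>\<close> contains the
    same four integrals as the sum of \<open>y_sub\<close> at \<open>y\<close> and at
    \<open>\<sigma> y\<close>, so the right-hand sides agree.\<close>
  have ratio: "(F x + G x) * f y = f x * (F y + G y)" for x y
    using x_sub[of x y] x_sub\<sigma>[of x y] y_sub[of x y] y_sub[of x "\<sigma> y"]
    unfolding \<sigma>\<sigma> F\<sigma> by algebra
  define c where "c = (F a + G a) / (2 * f a)"
  have FGc: "F x + G x = 2 * c * f x" for x
  proof -
    have "F a + G a = 2 * c * f a"
      using a by (simp add: c_def)
    then have "(F x + G x) * f a = 2 * c * f x * f a"
      using ratio[of x a] by (simp add: mult_ac)
    then show ?thesis
      using a by simp
  qed
  \<comment> \<open>Both sides are the double integral of \<open>f (x * t * \<sigma> s)\<close>.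
    This trades \<open>G (x * s)\<close> for \<open>F (x * \<sigma> s)\<close>, to which
    \<open>K\<close> applies.\<close>
  have "L (\<lambda>s. F (x * \<sigma> s)) = L (\<lambda>s. G (x * s))" for x
  proof -
    have "L (\<lambda>s. F (x * \<sigma> s)) = L (\<lambda>s. L (\<lambda>t. f (x * t * \<sigma> s)))"
      unfolding F_def by (auto intro!: L_cong arg_cong[where f = f] center_right_commute involutive_automorphism_center[OF inv])
    also have "\<dots> = L (\<lambda>s. G (x * s))"
      unfolding G_def L_def by (rule dirac_integral_swap)
    finally show ?thesis .
  qed
  then have "L (\<lambda>s. F (x * s) + G (x * s)) = L (\<lambda>s. F (x * s) + F (x * \<sigma> s))" for x
    by (simp add: L_def dirac_integral_add)
  \<comment> \<open>By \<open>FGc\<close> the left integral is \<open>2 * c * F x\<close>; by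
    \<open>K\<close> with \<open>y = s\<close> the right one is
    \<open>2 * f x * L f\<close>.\<close>
  then have cF: "c * F x = L f * f x" for x
    unfolding FGc K L_def dirac_integral_mult_left by (simp add: F_def L_def mult.commute)
  have "c \<noteq> 0"
  proof
    assume "c = 0"
    then have "F (\<sigma> x) = - F x" for x
      using FGc[of x] by (simp add: F\<sigma> add_eq_0_iff)
    \<comment> \<open>Passing from \<open>(a, a)\<close> to \<open>(\<sigma> a, \<sigma> a)\<close>
      in \<open>K\<close> negates the left side but, \<open>f\<close> being even, fixes the right
      side, so \<open>f a\<close> would vanish.\<close>
    then have "- (F (a * a) + F (a * \<sigma> a)) = 2 * f a * f a"
      using K[of "\<sigma> a" "\<sigma> a"] by (simp add: even flip: \<sigma>m)
    then show False
      using a by (simp add: K)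
  qed
  moreover have F: "F x = c * f x" for x
  proof -
    have "c * F x = c * F (\<sigma> x)"
      by (simp only: cF even)
    then show ?thesis
      using FGc[of x] \<open>c \<noteq> 0\<close> by (simp add: F\<sigma>)
  qed
  moreover have "L f = c\<^sup>2"
    using cF[of a] a by (simp add: F power2_eq_square)
  ultimately show thesis
    using that[of c] by (simp add: F_def L_def)
qed

text \<open>The eigenvalue condition pulls a second factor \<open>?c\<close> out of each integral,
  which leaves d'Alembert's equation multiplied by \<open>?c * ?c\<close>.\<close>

lemma T_map_mem_kannappan_set:
  assumes "g \<in> dalembert_set \<sigma> I \<alpha> z"
  shows "T_map I \<alpha> z g \<in> kannappan_set \<sigma> I \<alpha> z"
proof -
  let ?c = "dirac_integral I \<alpha> z g"
  have g: "g (x * y) + g (x * \<sigma> y) = 2 * g x * g y" and c: "?c \<noteq> 0"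
    and eig: "dirac_integral I \<alpha> z (\<lambda>t. g (x * t)) = g x * ?c" for x y
    using assms by (auto simp: dalembert_set_def)
  have "g \<noteq> (\<lambda>_. 0)"
    using c by (auto simp: dirac_integral_def)
  then have "T_map I \<alpha> z g \<noteq> (\<lambda>_. 0)"
    using c by (auto simp: T_map_def fun_eq_iff)
  moreover have "?c * (g (x * y) * ?c) + ?c * (g (x * \<sigma> y) * ?c) = 2 * (?c * g x) * (?c * g y)" for x y
  proof -
    have "?c * (g (x * y) * ?c) + ?c * (g (x * \<sigma> y) * ?c) = ?c * ?c * (g (x * y) + g (x * \<sigma> y))"
      by (simp add: algebra_simps)
    then show ?thesis
      by (simp add: g)
  qed
  ultimately show ?thesis
    by (simp add: kannappan_set_def T_map_def dirac_integral_mult_left eig)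
qed

lemma dirac_integral_T_map:
  "dirac_integral I \<alpha> z (T_map I \<alpha> z g) = (dirac_integral I \<alpha> z g)\<^sup>2"
  by (simp add: T_map_def dirac_integral_mult_left power2_eq_square)

text \<open>Numerator and denominator share the square of the integral of \<open>g\<close>. As the
  quotient involves \<open>g\<close> only through its image, injectivity follows too.\<close>

lemma T_map_inverse:
  assumes "g \<in> dalembert_set \<sigma> I \<alpha> z"
  shows "g x = dirac_integral I \<alpha> z (\<lambda>t. T_map I \<alpha> z g (x * t)) / dirac_integral I \<alpha> z (T_map I \<alpha> z g)"
  using assms
  by (simp add: dirac_integral_T_map dalembert_set_def T_map_def dirac_integral_mult_left power2_eq_square)

lemma inj_on_T_map: "inj_on (T_map I \<alpha> z) (dalembert_set \<sigma> I \<alpha> z)"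
  by (rule inj_onI, rule ext) (metis T_map_inverse)

lemma kannappan_set_subset_T_map_image:
  fixes \<sigma> :: "'a::semigroup_mult \<Rightarrow> 'a"
  assumes inv: "involutive_automorphism \<sigma>"
    and cent: "\<And>i. i \<in> I \<Longrightarrow> z i \<in> semigroup_center"
  shows "kannappan_set \<sigma> I \<alpha> z \<subseteq> T_map I \<alpha> z ` dalembert_set \<sigma> I \<alpha> z"
proof
  fix f assume f: "f \<in> kannappan_set \<sigma> I \<alpha> z"
  obtain c where c: "c \<noteq> 0" and eig: "\<And>x. dirac_integral I \<alpha> z (\<lambda>t. f (x * t)) = c * f x"
    and int: "dirac_integral I \<alpha> z f = c\<^sup>2"
    using kannappan_eigenfunction[OF inv cent f] by blast
  \<comment> \<open>The scaling is chosen so that the integral of \<open>g\<close> is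
    \<open>c\<^sup>2 / c = c\<close>, exactly the factor by which \<open>T_map\<close>
    multiplies.\<close>
  define g where "g x = inverse c * f x" for x
  have int_g: "dirac_integral I \<alpha> z g = c"
    unfolding g_def using c by (simp add: dirac_integral_mult_left int power2_eq_square)
  have "c * (f (x * y) + f (x * \<sigma> y)) = 2 * f x * f y" for x y
    using f by (simp add: kannappan_set_def eig distrib_left)
  then have "g (x * y) + g (x * \<sigma> y) = 2 * g x * g y" for x y
    using c by (simp add: g_def field_simps)
  moreover have "dirac_integral I \<alpha> z (\<lambda>t. g (x * t)) = g x * dirac_integral I \<alpha> z g" for x
    unfolding int_g by (simp add: g_def dirac_integral_mult_left eig)
  ultimately have "g \<in> dalembert_set \<sigma> I \<alpha> z"
    using c by (simp add: dalembert_set_def int_g)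
  moreover have "f = T_map I \<alpha> z g"
    using c by (simp add: T_map_def int_g fun_eq_iff) (simp add: g_def)
  ultimately show "f \<in> T_map I \<alpha> z ` dalembert_set \<sigma> I \<alpha> z"
    by blast
qed

text \<open>Integrate d'Alembert's equation at \<open>y = t\<close>: the total is twice the claimed
  value, and the eigenvalue condition accounts for one half.\<close>

lemma dalembert_integral_\<sigma>:
  assumes "g \<in> dalembert_set \<sigma> I \<alpha> z"
  shows "dirac_integral I \<alpha> z (\<lambda>t. g (x * \<sigma> t)) = dirac_integral I \<alpha> z g * g x"
proof -
  have "dirac_integral I \<alpha> z (\<lambda>t. g (x * t) + g (x * \<sigma> t)) = dirac_integral I \<alpha> z (\<lambda>t. 2 * g x * g t)"
    using assms by (simp add: dalembert_set_def)
  then show ?thesis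
    using assms by (simp add: dalembert_set_def dirac_integral_add dirac_integral_mult_left)
qed

text \<open>Compose with scaling by \<open>c\<close> in one direction and by
  \<open>inverse c\<close> in the other.\<close>

lemma continuous_map_cmult_iff:
  fixes g :: "'a \<Rightarrow> 'b::real_normed_field"
  assumes "c \<noteq> 0"
  shows "continuous_map X euclidean (\<lambda>x. c * g x) \<longleftrightarrow> continuous_map X euclidean g"
proof -
  have scale: "continuous_map X euclidean (\<lambda>x. b * h x)" if "continuous_map X euclidean h"
    for b and h :: "'a \<Rightarrow> 'b"
    using continuous_map_compose[OF that, of euclidean "\<lambda>y. b * y"]
    by (simp add: o_def continuous_intros)
  show ?thesis
    using scale[of g c] scale[of "\<lambda>x. c * g x" "inverse c"] assms
    by (auto simp flip: mult.assoc)
qed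

theorem theorem2p2:
  fixes \<sigma> :: "'a::semigroup_mult \<Rightarrow> 'a"
    and I :: "'i set" and \<alpha> :: "'i \<Rightarrow> complex" and z :: "'i \<Rightarrow> 'a"
  assumes "involutive_automorphism \<sigma>"
    and "finite I"
    and "\<And>i. i \<in> I \<Longrightarrow> z i \<in> semigroup_center"
  shows
    "(bij_betw (T_map I \<alpha> z) (dalembert_set \<sigma> I \<alpha> z) (kannappan_set \<sigma> I \<alpha> z) \<and>
      (\<forall>f \<in> kannappan_set \<sigma> I \<alpha> z.
         dirac_integral I \<alpha> z f \<noteq> 0 \<and>
         (\<forall>x. inv_into (dalembert_set \<sigma> I \<alpha> z) (T_map I \<alpha> z) f x =
                dirac_integral I \<alpha> z (\<lambda>t. f (x * t)) / dirac_integral I \<alpha> z f)))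
     \<and>
     (\<forall>f \<in> kannappan_set \<sigma> I \<alpha> z. \<exists>g \<in> dalembert_set \<sigma> I \<alpha> z.
         f = (\<lambda>x. dirac_integral I \<alpha> z g * g x))
     \<and>
     (\<forall>f \<in> kannappan_set \<sigma> I \<alpha> z. \<forall>g \<in> dalembert_set \<sigma> I \<alpha> z.
         f = (\<lambda>x. dirac_integral I \<alpha> z g * g x) \<longrightarrow>
           (\<forall>x. f x = dirac_integral I \<alpha> z (\<lambda>t. g (x * t)) \<and>
                dirac_integral I \<alpha> z (\<lambda>t. g (x * t)) = dirac_integral I \<alpha> z (\<lambda>t. g (x * \<sigma> t)) \<and>
                dirac_integral I \<alpha> z (\<lambda>t. g (x * \<sigma> t)) = dirac_integral I \<alpha> z g * g x)
         \<and> (central_fun f \<longleftrightarrow> central_fun g)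
         \<and> (\<forall>X :: 'a topology. topspace X = UNIV \<and> continuous_map X X \<sigma> \<longrightarrow>
              (continuous_map X euclidean f \<longleftrightarrow> continuous_map X euclidean g)))"
proof (intro conjI ballI impI allI)
  let ?A = "dalembert_set \<sigma> I \<alpha> z" and ?K = "kannappan_set \<sigma> I \<alpha> z" and ?T = "T_map I \<alpha> z"
  have sub: "?K \<subseteq> ?T ` ?A"
    using kannappan_set_subset_T_map_image assms(1,3) by blast
  then show "bij_betw ?T ?A ?K"
    using T_map_mem_kannappan_set inj_on_T_map by (fastforce simp: bij_betw_def)
  {
    fix f assume "f \<in> ?K"
    then obtain g where g: "g \<in> ?A" "f = ?T g"
      using sub by blast
    then show "dirac_integral I \<alpha> z f \<noteq> 0"
      by (simp add: dirac_integral_T_map dalembert_set_def)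
    fix x
    show "inv_into ?A ?T f x = dirac_integral I \<alpha> z (\<lambda>t. f (x * t)) / dirac_integral I \<alpha> z f"
      using g T_map_inverse[OF g(1)] by (simp add: inv_into_f_f[OF inj_on_T_map])
  }
  show "\<exists>g\<in>?A. f = (\<lambda>x. dirac_integral I \<alpha> z g * g x)" if "f \<in> ?K" for f
    using sub that by (auto simp: T_map_def)
  fix f g
  assume g: "g \<in> ?A" and f: "f = (\<lambda>x. dirac_integral I \<alpha> z g * g x)"
  have c: "dirac_integral I \<alpha> z g \<noteq> 0"
    and eig: "\<And>x. dirac_integral I \<alpha> z (\<lambda>t. g (x * t)) = dirac_integral I \<alpha> z g * g x"
    using g by (auto simp: dalembert_set_def)
  show "f x = dirac_integral I \<alpha> z (\<lambda>t. g (x * t))" for x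
    by (simp add: f eig)
  show "dirac_integral I \<alpha> z (\<lambda>t. g (x * t)) = dirac_integral I \<alpha> z (\<lambda>t. g (x * \<sigma> t))" for x
    by (simp add: eig dalembert_integral_\<sigma>[OF g])
  show "dirac_integral I \<alpha> z (\<lambda>t. g (x * \<sigma> t)) = dirac_integral I \<alpha> z g * g x" for x
    by (rule dalembert_integral_\<sigma>[OF g])
  \<comment> \<open>\<open>f\<close> is a nonzero constant multiple of \<open>g\<close>, so the
    factor cancels.\<close>
  show "central_fun f \<longleftrightarrow> central_fun g"
    using c by (simp add: central_fun_def f)
  show "continuous_map X euclidean f \<longleftrightarrow> continuous_map X euclidean g" for X :: "'a topology"
    using c by (simp add: f continuous_map_cmult_iff)
qed

end
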